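(* Let $p>24318$ be a prime, let $G$ be a cyclic group of order $p$ (written additively), and let $S$ be a sequence over $G$ of length $|S|=p$. If $\mathsf h(S)\ge \frac{p-2}{10}$, then $S$ has a subsequence $T$ with $\operatorname{ind}(T)=1$.
   Context: A sequence over $G$ is a finite unordered sequence of elements of $G$ with repetition allowed (a finite multiset); its length $|S|$ is the number of terms counted with multiplicity, a subsequence is a sub-multiset, and $\mathsf h(S)$ denotes the maximum of the multiplicities of the elements of $G$ in $S$. For a sequence $T$ over the cyclic group $G$ of order $p$ and $h\in G$ with $\operatorname{ord}(h)=p$, write $T=(n_1h)\cdot\ldots\cdot(n_lh)$ with integers $n_1,\ldots,n_l\in[1,p]$ and put $\|T\|_h=\frac{n_1+\cdots+n_l}{p}$. The index of $T$ is $\operatorname{ind}(T)=\min\{\|T\|_h : h\in G,\ \operatorname{ord}(h)=p\}$. *)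

theory Defs
  imports Complex_Main "HOL-Library.Multiset" "HOL-Computational_Algebra.Primes" "HOL-Algebra.Elementary_Groups"
    "HOL-Algebra.Multiplicative_Group"
begin

(* HOL-Algebra writes groups multiplicatively: the element n h of the additive group G is
   h [^] n, and the statements about a cyclic group transfer verbatim. *)

definition sequence_over :: "('a, 'b) monoid_scheme \<Rightarrow> 'a multiset \<Rightarrow> bool" where
  "sequence_over G S \<longleftrightarrow> set_mset S \<subseteq> carrier G"

(* Meaningful for finite nonempty carrier G; elements that do not occur in S count with
   multiplicity 0. *)
definition max_mult :: "('a, 'b) monoid_scheme \<Rightarrow> 'a multiset \<Rightarrow> nat" where
  "max_mult G S = Max (count S ` carrier G)"

(* The coefficient ranges over [1, order G], not [0, order G - 1]: the identity element has
   coefficient order G. *)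
definition coefficient :: "('a, 'b) monoid_scheme \<Rightarrow> 'a \<Rightarrow> 'a \<Rightarrow> nat" where
  "coefficient G h x = (THE n. n \<in> {1..order G} \<and> x = h [^]\<^bsub>G\<^esub> n)"

lemma (in group) coefficient_ex1:
  assumes fin: "finite (carrier G)"
    and h: "h \<in> carrier G" "ord h = order G" and x: "x \<in> carrier G"
  shows "\<exists>!n. n \<in> {1..order G} \<and> x = h [^] n"
proof -
  have inj: "inj_on (\<lambda>n. h [^] n) {1..order G}"
    using ord_inj'[OF h(1)] h(2) by simp
  have "(\<lambda>n. h [^] n) ` {1..order G} = carrier G"
  proof (rule card_subset_eq[OF fin])
    show "(\<lambda>n. h [^] n) ` {1..order G} \<subseteq> carrier G"
      using h(1) by auto
    show "card ((\<lambda>n. h [^] n) ` {1..order G}) = card (carrier G)"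
      using card_image[OF inj] by (simp add: order_def)
  qed
  then obtain n where "n \<in> {1..order G}" "x = h [^] n"
    using x by blast
  then show ?thesis
    using inj_onD[OF inj] by blast
qed

definition seq_norm :: "('a, 'b) monoid_scheme \<Rightarrow> 'a \<Rightarrow> 'a multiset \<Rightarrow> real" where
  "seq_norm G h T = (\<Sum>x\<in>#T. real (coefficient G h x)) / real (order G)"

definition seq_index :: "('a, 'b) monoid_scheme \<Rightarrow> 'a multiset \<Rightarrow> real" where
  "seq_index G T = Min {seq_norm G h T | h. h \<in> carrier G \<and> group.ord G h = order G}"

end

(* Scale the most frequent term to 1, so that S consists of h >= (p - 1) / 10 ones and residues
   y in [2, p - 1], and apply Dirichlet's theorem to each y: q y = j p + a (or j p - a) with q <= 9,
   gcd(q, j) = 1 and 0 <= a <= h. Multiplying by m turns the ones into h copies of m, so it suffices to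
   find residues whose multiples m y mod p have a sum in [p - m h, p] congruent to p modulo m.

   If y approximates j p / q from below, any q such terms with the same fraction j / q suffice, with
   m the inverse of j modulo q; hence there are few terms of this kind. If y approximates from above, then
   m y mod p = (m / q) a whenever q divides m and a is small. Taking m = q shows that few a can be
   large. Two frequent denominators with least common multiple m >= 10 give a solution at once, because then
   m h >= p - 1. Otherwise all frequent denominators divide one m <= 9, and multiplication by m
   makes all but a bounded number of the terms small positive integers, of which at most h equal 1. Their
   sum is then too large to stay below p, and blocks of q terms with a common fraction have weight at most
   m h and divisible by m, so the sums cannot jump over the window [p - m h, p]. *)

theory Submission
  imports Defs "HOL-Number_Theory.Cong"
begin

section \<open>Multisets and Diophantine approximation\<close>

lemma exists_submset_of_size:
  assumes "n \<le> size M"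
  shows "\<exists>X. X \<subseteq># M \<and> size X = n"
  using assms
proof (induction n)
  case 0
  show ?case by (intro exI[of _ "{#}"]) simp
next
  case (Suc n)
  then obtain X where X: "X \<subseteq># M" "size X = n"
    by auto
  then have "M - X \<noteq> {#}"
    using Suc.prems by (metis Suc_n_not_le_n add_0_right size_empty subset_mset.add_diff_inverse)
  then obtain x where "x \<in># M - X"
    by (meson multiset_nonemptyE)
  then have "add_mset x X \<subseteq># M"
    using X(1) by (metis insert_subset_eq_iff mset_subset_eq_insertD subset_mset.le_diff_conv2 add_mset_add_single
        mset_subset_eq_single add.commute)
  then show ?case
    using X(2) by (intro exI[of _ "add_mset x X"]) simp
qed

lemma size_le_card_times_fibre:
  assumes "finite F" "\<And>y. y \<in># M \<Longrightarrow> c y \<in> F"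
    and "\<And>f. f \<in> F \<Longrightarrow> size (filter_mset (\<lambda>y. c y = f) M) \<le> N"
  shows "size M \<le> card F * N"
proof -
  have "size M = (\<Sum>f\<in>F. size (filter_mset (\<lambda>y. c y = f) M))"
    using assms(2)
  proof (induction M)
    case (add x M)
    have "(\<Sum>f\<in>F. size (filter_mset (\<lambda>y. c y = f) (add_mset x M)))
        = (\<Sum>f\<in>F. size (filter_mset (\<lambda>y. c y = f) M) + (if c x = f then 1 else 0))"
      by (intro sum.cong) auto
    also have "\<dots> = size M + 1"
      using add assms(1) by (simp add: sum.distrib)
    finally show ?case by simp
  qed simp
  also have "\<dots> \<le> card F * N"
    using sum_bounded_above[of F _ N] assms(3) by simp
  finally show ?thesis .
qed

text \<open>Take \<open>X\<close> of maximal size: a further block would keep the sum in the same class and below \<open>P\<close>.\<close>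

lemma submset_no_small_block:
  fixes w :: "'a \<Rightarrow> nat"
  assumes "X0 \<subseteq># V" "(\<Sum>y\<in>#X0. w y) \<le> P" "m dvd P - (\<Sum>y\<in>#X0. w y)"
  obtains X where "X \<subseteq># V" "(\<Sum>y\<in>#X. w y) \<le> P" "m dvd P - (\<Sum>y\<in>#X. w y)"
    "\<And>B. \<lbrakk>P > (\<Sum>y\<in>#X. w y) + D; B \<subseteq># V - X; m dvd (\<Sum>y\<in>#B. w y); (\<Sum>y\<in>#B. w y) \<le> D\<rbrakk> \<Longrightarrow> B = {#}"
proof -
  define A where "A = {X. X \<subseteq># V \<and> (\<Sum>y\<in>#X. w y) \<le> P \<and> m dvd P - (\<Sum>y\<in>#X. w y)}"
  have "X0 \<in> A"
    using assms unfolding A_def by simp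
  moreover have bound: "\<And>X. X \<in> A \<Longrightarrow> size X \<le> size V"
    unfolding A_def by (simp add: size_mset_mono)
  ultimately obtain X where X: "X \<in> A" and Xmax: "\<And>Y. Y \<in> A \<Longrightarrow> size Y \<le> size X"
    using ex_has_greatest_nat[of "\<lambda>X. X \<in> A" X0 size "Suc (size V)"] by (meson le_imp_less_Suc less_imp_le)
  show thesis
  proof (rule that[of X])
    show "X \<subseteq># V" "(\<Sum>y\<in>#X. w y) \<le> P" "m dvd P - (\<Sum>y\<in>#X. w y)"
      using X by (auto simp: A_def)
    fix B
    assume B: "P > (\<Sum>y\<in>#X. w y) + D" "B \<subseteq># V - X" "m dvd (\<Sum>y\<in>#B. w y)" "(\<Sum>y\<in>#B. w y) \<le> D"
    have "X + B \<subseteq># V"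
      using B(2) X unfolding A_def
      by (metis (no_types, lifting) add.commute mem_Collect_eq subset_mset.le_diff_conv2)
    moreover have "m dvd P - (\<Sum>y\<in>#X. w y)"
      using X by (simp add: A_def)
    then have "m dvd (P - (\<Sum>y\<in>#X. w y)) - (\<Sum>y\<in>#B. w y)"
      using B(3) by (rule dvd_diff_nat)
    then have "m dvd P - (\<Sum>y\<in>#X+B. w y)"
      by simp
    ultimately have "X + B \<in> A"
      using B(1,4) unfolding A_def by simp
    then show "B = {#}"
      using Xmax[of "X + B"] by simp
  qed
qed

section \<open>Diophantine approximation and small denominators\<close>

text \<open>Pigeonhole: the residues \<open>k * y mod p\<close> with \<open>k\<close> in
  \<open>{0..N}\<close> lie in \<open>N + 1\<close> boxes of width \<open>p / (N+1)\<close>. Either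
  two share a box and their difference is small, or every box is hit and the residue in the top box
  is close to \<open>p\<close>.\<close>

lemma dirichlet_approx_nat:
  fixes p y N :: nat
  assumes "p > 0" "N > 0"
  obtains q j :: nat where "q \<in> {1..N}" "coprime q j" "int (N+1) * \<bar>int (q * y) - int (j * p)\<bar> \<le> int p"
proof -
  define box where "box k = (N+1) * (k * y mod p) div p" for k
  have box_less: "box k < N + 1" for k
  proof -
    have "(N+1) * (k * y mod p) < (N+1) * p"
      using assms(1) by (intro mult_strict_left_mono) auto
    then show ?thesis
      unfolding box_def using assms(1) by (subst div_less_iff_less_mult) auto
  qed
  have box_bounds: "box k * p \<le> (N+1) * (k * y mod p)" "(N+1) * (k * y mod p) < box k * p + p" for k
    unfolding box_def
    by (rule div_times_less_eq_dividend, metis add.commute assms(1) dividend_less_div_times)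
  have ky: "k * y = (k * y div p) * p + (k * y mod p)" for k
    by simp
  have "\<exists>q j :: nat. q \<in> {1..N} \<and> int (N+1) * \<bar>int (q * y) - int (j * p)\<bar> \<le> int p"
  proof (cases "inj_on box {0..N}")
    case True
    have "box ` {0..N} = {0..N}"
      by (rule card_subset_eq) (use box_less True in \<open>auto simp: card_image less_Suc_eq_le\<close>)
    then obtain k where k: "k \<in> {0..N}" "box k = N"
      by (metis atLeastAtMost_iff imageE le0 le_refl)
    have "box 0 = 0"
      by (simp add: box_def)
    then have "k \<noteq> 0"
      using k assms(2) by (intro notI) simp
    then have "k \<in> {1..N}"
      using k(1) by simp
    \<comment> \<open>A residue in the top box lies just below \<open>p\<close>, so
      \<open>k * y\<close> is compared with the next multiple of \<open>p\<close>; hence the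
      \<open>Suc\<close>.\<close>
    moreover have "int (N+1) * \<bar>int (k * y) - int (Suc (k * y div p) * p)\<bar> \<le> int p"
    proof -
      define r where "r = k * y mod p"
      have r: "r < p" unfolding r_def using assms(1) by simp
      have "int (k * y) - int (Suc (k * y div p) * p) = int r - int p"
        unfolding r_def by (subst ky) (simp add: algebra_simps del: of_nat_mult flip: of_nat_add)
      moreover have "N * p \<le> (N+1) * r"
        using box_bounds(1)[of k] k(2) unfolding r_def by simp
      then have "int N * int p \<le> (int N + 1) * int r"
        by (metis of_nat_1 of_nat_add of_nat_le_iff of_nat_mult)
      ultimately show ?thesis
        using r by (simp add: abs_if algebra_simps)
    qed
    ultimately show ?thesis
      by blast
  next
    case False
    then obtain k l where kl: "k \<in> {0..N}" "l \<in> {0..N}" "k < l" "box k = box l"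
      unfolding inj_on_def by (metis linorder_neqE_nat)
    define r s where "r = k * y mod p" and "s = l * y mod p"
    have eq: "int ((l - k) * y) - int ((l * y div p - k * y div p) * p) = int s - int r"
    proof -
      have "k * y div p \<le> l * y div p"
        using kl(3) by (intro div_le_mono mult_le_mono1) simp
      moreover have "int (l * y) = int (l * y div p) * int p + int s" "int (k * y) = int (k * y div p) * int p + int r"
        unfolding r_def s_def by (metis ky of_nat_add of_nat_mult)+
      ultimately show ?thesis
        using kl(3) by (simp add: of_nat_diff algebra_simps)
    qed
    have "(N+1) * s < (N+1) * r + p" "(N+1) * r < (N+1) * s + p"
      using box_bounds[of k] box_bounds[of l] unfolding kl(4) r_def s_def by linarith+
    then have "int (N+1) * int s < int (N+1) * int r + int p" "int (N+1) * int r < int (N+1) * int s + int p"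
      by (metis of_nat_add of_nat_less_iff of_nat_mult)+
    then have "int (N+1) * \<bar>int s - int r\<bar> \<le> int p"
      by (simp add: abs_if algebra_simps)
    then show ?thesis
      using eq kl by (intro exI[of _ "l - k"] exI[of _ "l * y div p - k * y div p"]) auto
  qed
  then obtain q j :: nat where qj: "q \<in> {1..N}" "int (N+1) * \<bar>int (q * y) - int (j * p)\<bar> \<le> int p"
    by blast
  \<comment> \<open>Dividing out the common factor keeps the denominator in range and does not
    increase the error.\<close>
  define g where "g = gcd q j"
  have g: "g > 0"
    using qj(1) unfolding g_def by simp
  obtain q' j' where q': "q = q' * g" "j = j' * g" "coprime q' j'"
    using gcd_coprime_exists[of q j] g unfolding g_def by auto
  have "\<bar>int (q' * y) - int (j' * p)\<bar> * 1 \<le> \<bar>int (q' * y) - int (j' * p)\<bar> * int g"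
    using g by (intro mult_left_mono) auto
  also have "\<dots> = \<bar>(int (q' * y) - int (j' * p)) * int g\<bar>"
    by (simp add: abs_mult)
  also have "(int (q' * y) - int (j' * p)) * int g = int (q * y) - int (j * p)"
    unfolding q' by (simp add: algebra_simps)
  finally have "int (N+1) * \<bar>int (q' * y) - int (j' * p)\<bar> \<le> int (N+1) * \<bar>int (q * y) - int (j * p)\<bar>"
    by (intro mult_left_mono) auto
  moreover have "q' \<in> {1..N}"
  proof -
    have "q' > 0" using qj(1) q'(1) by (cases q') auto
    moreover have "q' \<le> q" using g q'(1) by simp
    ultimately show ?thesis using qj(1) by simp
  qed
  ultimately show thesis
    using that[of q' j'] q'(3) qj(2) by linarith
qed

text \<open>A check of all 729 triples. It lets the pair with the largest lcm provide a common
  modulus for every denominator in use.\<close>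

lemma dvd_lcm_of_max_lcm:
  fixes q r s :: nat
  assumes "q \<in> {1..9}" "r \<in> {1..9}" "s \<in> {1..9}" "lcm q r \<le> 9" "lcm q s \<le> lcm q r" "lcm r s \<le> lcm q r"
  shows "s dvd lcm q r"
proof -
  have "\<forall>q \<in> set [1..<10]. \<forall>r\<in> set [1..<10]. \<forall>s\<in> set [1..<10]. lcm q r \<le> (9::nat) \<longrightarrow> lcm q s \<le> lcm q r \<longrightarrow>
     lcm r s \<le> lcm q r \<longrightarrow> s dvd lcm q r"
    by code_simp
  then show ?thesis using assms by auto
qed

text \<open>The Farey fractions \<open>j / q\<close> of order 9, with both endpoints
  \<open>0 / 1\<close> and \<open>1 / 1\<close>.\<close>

definition fractions :: "(nat \<times> nat) set" where
  "fractions = {(q, j). q \<in> {1..9} \<and> j \<le> q \<and> coprime q j}"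

lemma finite_fractions: "finite fractions"
  by (rule finite_subset[of _ "{1..9} \<times> {0..9}"]) (auto simp: fractions_def)

lemma card_fractions: "card fractions = 29"
proof -
  have "fractions = set (filter (\<lambda>(q, j). j \<le> q \<and> coprime q j) (List.product [1..<10] [0..<10]))"
    unfolding fractions_def by auto
  moreover have "card \<dots> = 29"
    by code_simp
  ultimately show ?thesis by simp
qed


lemma sum_mset_le_size_times:
  fixes f :: "'a \<Rightarrow> nat"
  assumes "\<And>y. y \<in># X \<Longrightarrow> f y \<le> c"
  shows "(\<Sum>y\<in>#X. f y) \<le> size X * c"
  using assms by (induction X) (auto intro!: add_mono)

lemma size_times_le_sum_mset:
  fixes f :: "'a \<Rightarrow> nat"
  assumes "\<And>y. y \<in># X \<Longrightarrow> c \<le> f y"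
  shows "size X * c \<le> (\<Sum>y\<in>#X. f y)"
  using assms by (induction X) (auto intro!: add_mono)

lemma two_size_le_sum_mset:
  fixes f :: "'a \<Rightarrow> nat"
  assumes "\<And>y. y \<in># X \<Longrightarrow> 1 \<le> f y"
  shows "2 * size X \<le> (\<Sum>y\<in>#X. f y) + size (filter_mset (\<lambda>y. f y = 1) X)"
  using assms
proof (induction X)
  case (add y X)
  then show ?case using add.prems[of y] by fastforce
qed simp

section \<open>Congruences modulo the lcm of two denominators\<close>

lemma ex_residue_solving_cong:
  fixes q j :: nat and A :: int
  assumes "coprime q j" "q > 0"
  shows "\<exists>x<q. int q dvd int j * int x - A"
proof -
  obtain i where "[int j * i = 1] (mod int q)"
    using cong_solve_coprime_int[of "int j" "int q"] assms(1) by (auto simp: coprime_commute)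
  then have "[int j * i * A = 1 * A] (mod int q)"
    by (rule cong_mult) simp
  moreover have "[(i * A) mod int q = i * A] (mod int q)"
    by simp
  then have "[int j * ((i * A) mod int q) = int j * (i * A)] (mod int q)"
    by (intro cong_mult) auto
  ultimately have "[int j * ((i * A) mod int q) = A] (mod int q)"
    by (metis cong_trans mult.assoc mult_1)
  then show ?thesis
    using assms(2) by (intro exI[of _ "nat ((i * A) mod int q)"])
      (simp add: cong_iff_dvd_diff nat_less_iff)
qed

text \<open>With \<open>u = m div q1\<close> and \<open>v = m div q2\<close> coprime, write
  \<open>u * A - v * B = 1\<close> and solve \<open>j1 * x \<equiv> - A\<close> modulo
  \<open>q1\<close> and \<open>j2 * z \<equiv> B\<close> modulo \<open>q2\<close>. Multiplied by
  \<open>u\<close> and \<open>v\<close>, both congruences hold modulo \<open>m\<close>. The counts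
  \<open>x\<close> and \<open>z\<close> later steer a weight into the class of \<open>p\<close>
  modulo \<open>m\<close>.\<close>

lemma ex_coefficients_minus_one:
  fixes q1 q2 j1 j2 :: nat
  defines "m \<equiv> lcm q1 q2"
  assumes "coprime q1 j1" "coprime q2 j2" "q1 > 0" "q2 > 0"
  shows "\<exists>x<q1. \<exists>z<q2. m dvd 1 + (m div q1) * j1 * x + (m div q2) * j2 * z"
proof -
  define u v where "u = m div q1" and "v = m div q2"
  have uv: "u * q1 = m" "v * q2 = m"
    unfolding u_def v_def m_def by simp_all
  \<comment> \<open>A common factor \<open>d\<close> of \<open>u\<close> and \<open>v\<close> would
    make \<open>m / d\<close> a common multiple of \<open>q1\<close> and \<open>q2\<close>.\<close>
  have "coprime u v"
  proof (rule coprimeI)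
    fix d assume d: "d dvd u" "d dvd v"
    have "m > 0" using assms unfolding m_def by (simp add: lcm_pos_nat)
    obtain u' v' where u': "u = d * u'" "v = d * v'" using d by (auto elim!: dvdE)
    have "d > 0" using u' uv \<open>m > 0\<close> by (cases d) auto
    have m1: "m = d * (u' * q1)" "m = d * (v' * q2)" using u' uv by (simp_all add: mult_ac)
    then have eq: "u' * q1 = v' * q2" using \<open>d > 0\<close> by simp
    have "q1 dvd u' * q1" "q2 dvd u' * q1" by simp (simp add: eq)
    then have "m dvd u' * q1" unfolding m_def by (rule lcm_least)
    then have "d * (u' * q1) dvd 1 * (u' * q1)" using m1(1) by simp
    moreover have "u' * q1 > 0" using m1(1) \<open>m > 0\<close> by (cases "u' * q1") auto
    ultimately have "d * (u' * q1) \<le> 1 * (u' * q1)" by (intro dvd_imp_le) auto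
    then have "d \<le> 1" using \<open>u' * q1 > 0\<close> by (metis mult_le_cancel2)
    then show "is_unit d" using \<open>d > 0\<close> by simp
  qed
  then obtain A where "[int u * A = 1] (mod int v)"
    using cong_solve_coprime_int[of "int u" "int v"] by auto
  then obtain B where AB: "int u * A - 1 = int v * B"
    unfolding cong_iff_dvd_diff by (auto elim!: dvdE)
  obtain x where x: "x < q1" "int q1 dvd int j1 * int x - (- A)"
    using ex_residue_solving_cong[OF assms(2,4)] by blast
  obtain z where z: "z < q2" "int q2 dvd int j2 * int z - B"
    using ex_residue_solving_cong[OF assms(3,5)] by blast
  have "int u * int q1 dvd int u * (int j1 * int x - (- A))"
    "int v * int q2 dvd int v * (int j2 * int z - B)"
    using x(2) z(2) by (simp_all add: mult_dvd_mono)
  then have "int m dvd int u * (int j1 * int x - (- A)) + int v * (int j2 * int z - B)"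
    using uv by (metis dvd_add of_nat_mult)
  also have "int u * (int j1 * int x - (- A)) + int v * (int j2 * int z - B)
      = int (1 + u * j1 * x + v * j2 * z)"
    using AB by (simp add: algebra_simps)
  finally have "m dvd 1 + u * j1 * x + v * j2 * z"
    using int_dvd_int_iff by blast
  then show ?thesis using x(1) z(1) unfolding u_def v_def by blast
qed

text \<open>Take the pair with the largest lcm. If it is attained with equal entries, the partner 1
  gives the same lcm; hence the alternative \<open>r = 1\<close>.\<close>

lemma dominating_pair:
  fixes Q :: "nat set"
  assumes Q: "Q \<subseteq> {1..9}" "1 \<in> Q" and lcm: "\<And>s t. \<lbrakk>s \<in> Q; t \<in> Q; s \<noteq> t\<rbrakk> \<Longrightarrow> lcm s t \<le> 9"
  obtains q r where "q \<in> Q" "r \<in> Q" "q \<noteq> r \<or> r = 1" "lcm q r \<le> 9" "\<And>s. s \<in> Q \<Longrightarrow> s dvd lcm q r"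
proof -
  have lcm9: "lcm s t \<le> 9" if "s \<in> Q" "t \<in> Q" for s t
    using lcm[of s t] that Q(1) by (cases "s = t") auto
  define R where "R = (\<lambda>(s, t). lcm s t) ` (Q \<times> Q)"
  have "finite Q" using Q(1) finite_subset by blast
  then have R: "finite R" "R \<noteq> {}" using Q(2) unfolding R_def by auto
  obtain q r where qr: "q \<in> Q" "r \<in> Q" "lcm q r = Max R"
    using Max_in[OF R] unfolding R_def by auto
  have dvd: "s dvd lcm q r" if "s \<in> Q" for s
  proof (rule dvd_lcm_of_max_lcm)
    have "lcm q s \<in> R" "lcm r s \<in> R" using qr that unfolding R_def by auto
    then show "lcm q s \<le> lcm q r" "lcm r s \<le> lcm q r" using qr R by auto
  qed (use qr that Q(1) lcm9[OF qr(1,2)] in auto)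
  show thesis
  proof (cases "q = r")
    case True
    moreover have "q \<le> 9" using Q(1) qr(1) by auto
    ultimately show ?thesis using that[of q 1] Q(2) qr(1) dvd by simp
  next
    case False
    then show ?thesis using that[OF qr(1,2) _ lcm9[OF qr(1,2)] dvd] by simp
  qed
qed

section \<open>Sequences of residues with many ones\<close>

text \<open>\<open>W\<close> holds the terms other than 1 and \<open>h\<close> counts the ones. The
  functions \<open>q\<close> and \<open>j\<close> fix one Dirichlet approximation per term, so that
  terms can be sorted by fraction.\<close>

locale normalized_sequence =
  fixes p h :: nat and W :: "nat multiset" and q j :: "nat \<Rightarrow> nat"
  assumes prime_p: "prime p" and p_large: "24318 < p"
    and h: "p \<le> 10 * h + 1" and size_W: "size W + h = p"
    and W_range: "\<And>y. y \<in># W \<Longrightarrow> 2 \<le> y \<and> y < p"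
    and count_W: "\<And>y. count W y \<le> h"
    and frac: "\<And>y. y \<in># W \<Longrightarrow> (q y, j y) \<in> fractions"
    and approx: "\<And>y. y \<in># W \<Longrightarrow> 10 * \<bar>int (q y * y) - int (j y * p)\<bar> \<le> int p"
begin

section \<open>Weights of terms sorted by fraction\<close>

definition weight :: "nat \<Rightarrow> nat multiset \<Rightarrow> nat" where
  "weight m X = (\<Sum>y\<in>#X. m * y mod p)"

text \<open>The missing amount \<open>p - weight m X\<close> is filled up with ones, each of which contributes \<open>m\<close>.\<close>

definition solvable :: bool where
  "solvable \<longleftrightarrow> (\<exists>m X. 0 < m \<and> m < p \<and> X \<subseteq># W \<and> weight m X \<le> p \<and> p \<le> weight m X + m * h
     \<and> m dvd p - weight m X)"

definition right :: "nat \<Rightarrow> bool" where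
  "right y \<longleftrightarrow> j y * p < q y * y"

text \<open>Natural subtraction: this is the distance \<open>q y * y - j y * p\<close> for terms
  with \<open>right y\<close>, and 0 for the others.\<close>

definition err :: "nat \<Rightarrow> nat" where
  "err y = q y * y - j y * p"

abbreviation fibre :: "nat multiset \<Rightarrow> nat \<times> nat \<Rightarrow> nat multiset" where
  "fibre M c \<equiv> filter_mset (\<lambda>y. (q y, j y) = c) M"

lemma weight_union [simp]: "weight m (X + Y) = weight m X + weight m Y"
  by (simp add: weight_def)

lemma q_range: "y \<in># W \<Longrightarrow> 1 \<le> q y \<and> q y \<le> 9"
  using frac[of y] by (auto simp: fractions_def)

lemma q_times_eq: "right y \<Longrightarrow> q y * y = j y * p + err y"
  by (simp add: right_def err_def)

lemma err_bound: "\<lbrakk>y \<in># W; right y\<rbrakk> \<Longrightarrow> 10 * err y \<le> p"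
  using approx[of y] q_times_eq[of y] by simp

lemma err_le_h: "\<lbrakk>y \<in># W; right y\<rbrakk> \<Longrightarrow> err y \<le> h"
  using err_bound[of y] h by linarith

text \<open>\<open>m * y = (m div q y) * (q y * y)\<close>, and \<open>q y * y\<close> is congruent
  to \<open>err y\<close> modulo \<open>p\<close>.\<close>

lemma weight_right:
  assumes "right y" "q y dvd m" "(m div q y) * err y < p"
  shows "m * y mod p = (m div q y) * err y"
proof -
  have "m * y = (m div q y) * (q y * y)"
    using assms(2) by (metis dvd_div_mult_self mult.assoc)
  also have "\<dots> = (m div q y) * (j y * p + err y)"
    by (simp only: q_times_eq[OF assms(1)])
  also have "\<dots> = (m div q y) * err y + (m div q y) * j y * p"
    by (simp add: algebra_simps)
  finally show ?thesis
    using assms(3) by simp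
qed

text \<open>Read modulo \<open>m\<close>: each term shifts the weight by
  \<open>- (m div q0) * j0 * p\<close>, so \<open>q0\<close> terms of one fraction contribute a
  multiple of \<open>m\<close>. The exact equation avoids natural subtraction.\<close>

lemma weight_fibre:
  assumes "\<And>y. y \<in># X \<Longrightarrow> right y \<and> q y = q0 \<and> j y = j0 \<and> (m div q0) * err y < p" and "q0 dvd m"
  shows "weight m X + (m div q0) * j0 * size X * p = m * \<Sum>\<^sub># X"
  using assms(1)
proof (induction X)
  case (add y X)
  have y: "right y" "q y = q0" "j y = j0" "(m div q0) * err y < p"
    using add.prems[of y] by auto
  have "m * y = (m div q0) * (q0 * y)"
    using assms(2) by (metis dvd_div_mult_self mult.assoc)
  also have "\<dots> = m * y mod p + (m div q0) * j0 * p"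
    using q_times_eq[OF y(1)] weight_right[of y m] y assms(2) by (simp add: algebra_simps)
  finally have "m * y mod p + (m div q0) * j0 * p = m * y" ..
  moreover have "weight m X + (m div q0) * j0 * size X * p = m * \<Sum>\<^sub># X"
    using add by simp
  ultimately show ?case
    by (simp add: weight_def algebra_simps)
qed (simp add: weight_def)

lemma weight_le:
  assumes "X \<subseteq># W" "\<And>y. y \<in># X \<Longrightarrow> right y \<and> q y = q0 \<and> err y \<le> e \<and> (m div q0) * err y < p" and "q0 dvd m"
  shows "weight m X \<le> size X * ((m div q0) * e)"
  unfolding weight_def
proof (rule sum_mset_le_size_times)
  fix y assume "y \<in># X"
  then show "m * y mod p \<le> (m div q0) * e"
    using weight_right[of y m] assms(2)[of y] assms(3) by simp
qed

text \<open>The prime \<open>p\<close> divides neither \<open>q y\<close> nor \<open>y\<close>, as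
  both are positive and smaller. So a term that is not \<open>right\<close> lies strictly below its
  fraction.\<close>

lemma q_times_neq:
  assumes "y \<in># W"
  shows "q y * y \<noteq> j y * p"
proof
  assume "q y * y = j y * p"
  then have "p dvd q y \<or> p dvd y"
    using prime_p by (metis dvd_triv_right prime_dvd_mult_iff)
  then show False
    using q_range[OF assms] W_range[OF assms] p_large by (auto dest: dvd_imp_le)
qed

section \<open>Terms below their fraction\<close>

text \<open>If \<open>m\<close> is inverse to \<open>j\<close> modulo \<open>q\<close>, then \<open>m y mod p\<close> is slightly below \<open>p / q\<close>
  for each \<open>y\<close> slightly below \<open>j p / q\<close>.\<close>

lemma left_solvable:
  assumes X: "X \<subseteq># W" "size X = q0" "X \<noteq> {#}"
    and left: "\<And>y. y \<in># X \<Longrightarrow> q y = q0 \<and> j y = j0 \<and> \<not> right y"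
  shows solvable
proof -
  obtain x where "x \<in># X" using X(3) by blast
  then have xW: "x \<in># W" using X(1) by (meson mset_subset_eqD)
  have q0: "1 \<le> q0" "q0 \<le> 9" "coprime q0 j0"
    using frac[OF xW] left[OF \<open>x \<in># X\<close>] by (auto simp: fractions_def)
  have "j0 > 0"
    using q_times_neq[OF xW] left[OF \<open>x \<in># X\<close>] by (cases j0) (auto simp: right_def)
  \<comment> \<open>\<open>m\<close> is the inverse of \<open>j0\<close> modulo \<open>q0\<close>.
    For \<open>q0 = 1\<close> the least residue would be 0, so \<open>m = 1\<close> is chosen by
    hand.\<close>
  obtain m t where m: "1 \<le> m" "m \<le> q0" "m * j0 = 1 + t * q0"
  proof (cases "q0 = 1")
    case True
    then show thesis using that[of 1 "j0 - 1"] \<open>j0 > 0\<close> by simp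
  next
    case False
    obtain m0 where m0: "m0 < q0" "int q0 dvd int j0 * int m0 - 1"
      using ex_residue_solving_cong[OF q0(3), of 1] q0(1) by auto
    have "m0 \<noteq> 0"
    proof
      assume "m0 = 0"
      then have "int q0 dvd 1" using m0(2) by simp
      then show False using False by simp
    qed
    then have pos: "j0 * m0 \<ge> 1" using \<open>j0 > 0\<close> by simp
    then have "int j0 * int m0 - 1 = int (j0 * m0 - 1)"
      by (simp add: of_nat_diff)
    then have "q0 dvd j0 * m0 - 1"
      using m0(2) by (metis int_dvd_int_iff)
    then obtain t where "j0 * m0 - 1 = q0 * t" by (auto elim!: dvdE)
    then have "m0 * j0 = 1 + t * q0"
      using pos by (metis le_add_diff_inverse mult.commute)
    then show thesis using that[of m0 t] m0(1) \<open>m0 \<noteq> 0\<close> by simp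
  qed
  have each: "int q0 * int (m * y mod p) = int p - int m * (int j0 * int p - int q0 * int y)
      \<and> 0 \<le> int j0 * int p - int q0 * int y \<and> int j0 * int p - int q0 * int y \<le> int h" if "y \<in># X" for y
  proof -
    have yW: "y \<in># W" using that X(1) by (meson mset_subset_eqD)
    define r where "r = int j0 * int p - int q0 * int y"
    have qj: "q y = q0" "j y = j0" "\<not> right y"
      using left[OF that] by auto
    have "q0 * y < j0 * p"
      using qj(3) q_times_neq[OF yW] unfolding right_def qj(1,2) by linarith
    then have "int q0 * int y < int j0 * int p"
      by (metis of_nat_less_iff of_nat_mult)
    then have r: "0 < r" unfolding r_def by simp
    have r10: "10 * r \<le> int p"
      using approx[OF yW] left[OF that] r unfolding r_def by simp
    have mr: "int m * r < int p"
    proof -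
      have "int m * r \<le> 9 * r" using m(2) q0(2) r by (intro mult_right_mono) auto
      then show ?thesis using r10 r by linarith
    qed
    \<comment> \<open>\<open>v\<close> is \<open>m * y\<close> reduced modulo \<open>p\<close>:
      \<open>q0 * v = p - m * r\<close> lies strictly between 0 and \<open>p\<close>, and therefore
      so does \<open>v\<close>.\<close>
    define v where "v = int m * int y - int t * int p"
    have "int m * int j0 = 1 + int t * int q0"
      using m(3) by (metis of_nat_1 of_nat_add of_nat_mult)
    then have "int m * int j0 * int p = int p + int t * int q0 * int p"
      by (simp add: algebra_simps)
    then have v: "int q0 * v = int p - int m * r"
      unfolding v_def r_def by (simp add: algebra_simps)
    have "0 < int q0 * v" using v mr by simp
    then have "0 < v" using q0(1) by (simp add: zero_less_mult_iff)
    moreover have "int m * r > 0" using m(1) r by simp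
    then have "int q0 * v < int p" using v by simp
    moreover have "1 * v \<le> int q0 * v" using \<open>0 < v\<close> q0(1) by (intro mult_right_mono) auto
    ultimately have "0 \<le> v" "v < int p" by linarith+
    then have "v = v mod int p" by simp
    also have "v mod int p = int m * int y mod int p"
      unfolding v_def by (simp add: mod_diff_eq[symmetric])
    also have "\<dots> = int (m * y mod p)"
      by (simp add: of_nat_mod)
    finally show ?thesis
      using v r r10 h unfolding r_def by simp
  qed
  \<comment> \<open>The \<open>q0\<close> deficits \<open>j0 * p - q0 * y\<close> add up to
    \<open>q0 * k\<close>. Each is at most \<open>h\<close>, so \<open>k \<le> h\<close>; the weight
    is \<open>p - m * k\<close>, and \<open>k\<close> ones complete it.\<close>
  define k where "k = int j0 * int p - int (\<Sum>\<^sub># X)"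
  have sums: "int q0 * int (weight m Y) = int (size Y) * int p
      - int m * (int (size Y) * int j0 * int p - int q0 * int (\<Sum>\<^sub># Y))
      \<and> 0 \<le> int (size Y) * int j0 * int p - int q0 * int (\<Sum>\<^sub># Y)
      \<and> int (size Y) * int j0 * int p - int q0 * int (\<Sum>\<^sub># Y) \<le> int (size Y) * int h" if "Y \<subseteq># X" for Y
    using that
  proof (induction Y)
    case (add y Y)
    then have "Y \<subseteq># X" "y \<in># X"
      by (auto dest: mset_subset_eq_insertD simp: subset_mset.less_imp_le)
    then show ?case
      using add.IH each[of y] by (simp add: weight_def algebra_simps)
  qed (simp add: weight_def)
  have kq: "int (size X) * int j0 * int p - int q0 * int (\<Sum>\<^sub># X) = int q0 * k"
    unfolding k_def X(2) by (simp add: algebra_simps)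
  have "int q0 * int (weight m X) = int q0 * int p - int m * (int q0 * k)" "0 \<le> int q0 * k" "int q0 * k \<le> int q0 * int h"
    using sums[of X] unfolding kq unfolding X(2) by simp_all
  then have "int q0 * int (weight m X) = int q0 * (int p - int m * k)" "0 \<le> int q0 * k" "int q0 * k \<le> int q0 * int h"
    by (simp_all add: algebra_simps)
  then have "int (weight m X) = int p - int m * k" "0 \<le> k" "k \<le> int h"
    using q0(1) by (simp_all add: zero_le_mult_iff)
  moreover then obtain k' where "k = int k'" using nonneg_int_cases by blast
  ultimately have k': "int (weight m X + m * k') = int p" "k' \<le> h"
    by simp_all
  then have "weight m X + m * k' = p" using of_nat_eq_iff by blast
  moreover have "m * k' \<le> m * h" using k'(2) by simp
  ultimately have "weight m X \<le> p" "p \<le> weight m X + m * h" "p - weight m X = m * k'"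
    by linarith+
  then show ?thesis
    unfolding solvable_def using X(1) m(1,2) q0(2) p_large
    by (intro exI[of _ m] exI[of _ X]) auto
qed

lemma few_left:
  assumes "\<not> solvable" "c \<in> fractions"
  shows "size (fibre (filter_mset (\<lambda>y. \<not> right y) W) c) < fst c"
proof (rule ccontr)
  assume "\<not> ?thesis"
  then obtain X where X: "X \<subseteq># fibre (filter_mset (\<lambda>y. \<not> right y) W) c" "size X = fst c"
    using exists_submset_of_size[of "fst c"] by (auto simp: not_less)
  have "X \<noteq> {#}" using X(2) assms(2) by (auto simp: fractions_def)
  moreover have "X \<subseteq># W" using X(1) by (meson multiset_filter_subset subset_mset.order_trans)
  moreover have "q y = fst c \<and> j y = snd c \<and> \<not> right y" if "y \<in># X" for y
    using mset_subset_eqD[OF X(1) that] by auto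
  ultimately show False
    using left_solvable X(2) assms(1) by blast
qed

section \<open>Filling up with blocks of terms\<close>

text \<open>Take \<open>X\<close> maximal above \<open>X0\<close> in the class of \<open>p\<close>
  modulo \<open>m\<close>. Its weight stays below the window \<open>[p - m * h, p]\<close>, for
  otherwise ones would complete it. A block of \<open>q\<close> further terms with one fraction has
  weight divisible by \<open>m\<close> and at most \<open>m * h\<close>, so adding it would not
  exceed \<open>p\<close>; maximality excludes such blocks.\<close>

lemma residual:
  assumes "\<not> solvable" "0 < m" "m < p" "M \<subseteq># W"
    and M: "\<And>y. y \<in># M \<Longrightarrow> right y \<and> q y dvd m \<and> (m div q y) * err y < p"
    and X0: "X0 \<subseteq># M" "weight m X0 \<le> p" "m dvd p - weight m X0"
  obtains X where "X \<subseteq># M" "weight m X + m * h < p"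
    "\<And>c. c \<in> fractions \<Longrightarrow> size (fibre (M - X) c) < fst c"
proof -
  obtain X where X: "X \<subseteq># M" "weight m X \<le> p" "m dvd p - weight m X"
    and block: "\<And>B. \<lbrakk>p > weight m X + m * h; B \<subseteq># M - X; m dvd weight m B; weight m B \<le> m * h\<rbrakk> \<Longrightarrow> B = {#}"
    using submset_no_small_block[of X0 M "\<lambda>y. m * y mod p" p m "m * h"] X0 unfolding weight_def by blast
  have "X \<subseteq># W" using X(1) assms(4) by (rule subset_mset.order_trans)
  then have less: "weight m X + m * h < p"
    using assms(1-3) X unfolding solvable_def by (meson not_less)
  have "size (fibre (M - X) c) < fst c" if c: "c \<in> fractions" for c
  proof (rule ccontr)
    assume "\<not> ?thesis"
    then obtain B where B: "B \<subseteq># fibre (M - X) c" "size B = fst c"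
      using exists_submset_of_size[of "fst c"] by (auto simp: not_less)
    have BMX: "B \<subseteq># M - X" using B(1) by (meson multiset_filter_subset subset_mset.order_trans)
    then have BM: "B \<subseteq># M" by (meson diff_subset_eq_self subset_mset.order_trans)
    then have BW: "B \<subseteq># W" using assms(4) by (rule subset_mset.order_trans)
    have "B \<noteq> {#}" using B(2) c by (auto simp: fractions_def)
    have Bc: "q y = fst c \<and> j y = snd c" if "y \<in># B" for y
      using mset_subset_eqD[OF B(1) that] unfolding set_mset_filter by auto
    obtain x where "x \<in># B" using \<open>B \<noteq> {#}\<close> by blast
    then have dvd: "fst c dvd m" using M mset_subset_eqD[OF BM] Bc by metis
    have BM': "right y \<and> (m div fst c) * err y < p" if "y \<in># B" for y
      using M mset_subset_eqD[OF BM that] Bc[OF that] by metis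
    have "m dvd weight m B"
    proof -
      have "weight m B + (m div fst c) * snd c * size B * p = m * \<Sum>\<^sub># B"
        using weight_fibre[of B "fst c" "snd c" m] Bc BM' dvd by blast
      moreover have "(m div fst c) * snd c * size B * p = m * (snd c * p)"
        using dvd B(2) by (metis dvd_div_mult_self mult.assoc mult.commute)
      ultimately show ?thesis
        by (metis dvd_add_left_iff dvd_triv_left)
    qed
    \<comment> \<open>Each of the \<open>fst c\<close> terms has error at most \<open>h\<close> and
      so weighs at most \<open>(m div fst c) * h\<close>.\<close>
    moreover have "weight m B \<le> m * h"
    proof -
      have "weight m B \<le> size B * ((m div fst c) * h)"
        by (rule weight_le[OF BW _ dvd]) (use Bc BM' err_le_h mset_subset_eqD[OF BW] in auto)
      also have "\<dots> = m * h"
        using dvd B(2) by (metis dvd_mult_div_cancel mult.assoc)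
      finally show ?thesis .
    qed
    ultimately show False
      using block[OF less BMX] \<open>B \<noteq> {#}\<close> by blast
  qed
  then show thesis using that X(1) less by blast
qed

text \<open>Provides the start \<open>X0\<close> for \<open>residual\<close>: \<open>x\<close> terms
  with fraction \<open>j1 / q1\<close> and \<open>z\<close> terms with \<open>j2 / q2\<close>,
  counted as in \<open>ex_coefficients_minus_one\<close>. Their weight is congruent to
  \<open>p\<close> modulo \<open>m\<close>. That it is at most \<open>p\<close> depends on the size
  of the errors and is shown where the lemma is applied.\<close>

lemma base:
  assumes c: "(q1, j1) \<in> fractions" "(q2, j2) \<in> fractions" "q1 \<noteq> q2 \<or> q2 = 1"
    and m: "m = lcm q1 q2"
    and M: "\<And>y. \<lbrakk>y \<in># M; q y \<in> {q1, q2}\<rbrakk> \<Longrightarrow> right y \<and> (m div q y) * err y < p"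
    and sizes: "q1 - 1 \<le> size (fibre M (q1, j1))" "q2 - 1 \<le> size (fibre M (q2, j2))"
  obtains X1 X2 where "X1 + X2 \<subseteq># M" "size X1 < q1" "size X2 < q2"
    "\<And>y. y \<in># X1 \<Longrightarrow> q y = q1 \<and> j y = j1" "\<And>y. y \<in># X2 \<Longrightarrow> q y = q2 \<and> j y = j2"
    "weight m (X1 + X2) \<le> p \<Longrightarrow> m dvd p - weight m (X1 + X2)"
proof -
  have pos: "q1 > 0" "q2 > 0" "coprime q1 j1" "coprime q2 j2"
    using c by (auto simp: fractions_def)
  obtain x z where xz: "x < q1" "z < q2" "m dvd 1 + (m div q1) * j1 * x + (m div q2) * j2 * z"
    using ex_coefficients_minus_one[OF pos(3,4,1,2)] unfolding m by blast
  obtain X1 where X1: "X1 \<subseteq># fibre M (q1, j1)" "size X1 = x"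
    using exists_submset_of_size[of x "fibre M (q1, j1)"] xz(1) sizes(1) by force
  obtain X2 where X2: "X2 \<subseteq># fibre M (q2, j2)" "size X2 = z"
    using exists_submset_of_size[of z "fibre M (q2, j2)"] xz(2) sizes(2) by force
  have e1: "q y = q1 \<and> j y = j1 \<and> y \<in># M" if "y \<in># X1" for y
    using mset_subset_eqD[OF X1(1) that] by auto
  have e2: "q y = q2 \<and> j y = j2 \<and> y \<in># M" if "y \<in># X2" for y
    using mset_subset_eqD[OF X2(1) that] by auto
  \<comment> \<open>For \<open>q2 = 1\<close> the bound \<open>z < 1\<close> empties
    \<open>X2\<close>; otherwise the denominators differ and the two fibres are disjoint.\<close>
  have sub: "X1 + X2 \<subseteq># M"
  proof (cases "q2 = 1")
    case True
    then have "X2 = {#}" using X2(2) xz(2) by simp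
    then show ?thesis using X1(1) by (metis add.right_neutral multiset_filter_subset subset_mset.order_trans)
  next
    case False
    then have ne: "q1 \<noteq> q2" using c(3) by simp
    have "fibre M (q1, j1) + fibre M (q2, j2) \<subseteq># M"
      unfolding subseteq_mset_def using ne by auto
    then show ?thesis using X1(1) X2(1) by (meson subset_mset.add_mono subset_mset.order_trans)
  qed
  have w1: "weight m X1 + (m div q1) * j1 * x * p = m * \<Sum>\<^sub># X1"
    using weight_fibre[of X1 q1 j1 m] e1 M X1(2) m by auto
  have w2: "weight m X2 + (m div q2) * j2 * z * p = m * \<Sum>\<^sub># X2"
    using weight_fibre[of X2 q2 j2 m] e2 M X2(2) m by auto
  have "m dvd p - weight m (X1 + X2)" if "weight m (X1 + X2) \<le> p"
  proof -
    define s where "s = 1 + (m div q1) * j1 * x + (m div q2) * j2 * z"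
    have "(p - weight m (X1 + X2)) + m * (\<Sum>\<^sub># X1 + \<Sum>\<^sub># X2) = s * p"
      using w1 w2 that unfolding s_def by (simp add: algebra_simps)
    moreover have "m dvd s * p" using xz(3) unfolding s_def by (rule dvd_mult2)
    ultimately show ?thesis by (metis dvd_add_left_iff dvd_triv_left)
  qed
  then show thesis
    using that[of X1 X2] sub X1(2) X2(2) xz e1 e2 by blast
qed


section \<open>Large errors and pairs of frequent denominators\<close>

text \<open>81 bounds the lcm of two denominators. The threshold \<open>162 = 2 * 81\<close> for
  errors leaves weight \<open>p / 2\<close> for each of two groups in
  \<open>base_small\<close>.\<close>

lemma err_mult_less_p:
  assumes "162 * err y \<le> p" "q y \<noteq> 0" "m \<le> 81"
  shows "(m div q y) * err y < p"
proof -
  have "(m div q y) * err y \<le> 81 * err y"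
    using assms(3) div_le_dividend[of m "q y"] by (intro mult_le_mono1) linarith
  then show ?thesis using assms(1) p_large by linarith
qed

text \<open>Multiplication by \<open>q0\<close> turns each term into its error, here more than
  \<open>p / 162\<close>. By \<open>residual\<close> all but at most \<open>q0 - 1\<close> of these
  terms fit into a sum below \<open>p\<close>, so at most 161 of them do.\<close>

lemma few_large:
  assumes "\<not> solvable" "(q0, j0) \<in> fractions"
  shows "size (fibre (filter_mset (\<lambda>y. right y \<and> p < 162 * err y) W) (q0, j0)) \<le> q0 + 160"
proof (rule ccontr)
  define M where "M = fibre (filter_mset (\<lambda>y. right y \<and> p < 162 * err y) W) (q0, j0)"
  assume "\<not> ?thesis"
  then have size_M: "q0 + 160 < size M" by (simp add: M_def)
  have MW: "M \<subseteq># W" unfolding M_def by (meson multiset_filter_subset subset_mset.order_trans)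
  have M: "right y" "q y = q0" "j y = j0" "p < 162 * err y" "y \<in># W" if "y \<in># M" for y
    using that unfolding M_def by auto
  have q0: "1 \<le> q0" "q0 \<le> 9" using assms(2) by (auto simp: fractions_def)
  have M': "right y \<and> (q0 div q y) * err y < p" if "y \<in># M" for y
    using M[OF that] err_bound[of y] q0 p_large by simp
  have fibre_M: "fibre M (q0, j0) = M" using M by (simp add: filter_mset_eq_conv)
  \<comment> \<open>The fraction \<open>0 / 1\<close> is a dummy partner: fewer than one term is
    taken from it, and \<open>lcm q0 1 = q0\<close>.\<close>
  have one: "(1, 0) \<in> fractions" by (simp add: fractions_def)
  have l: "q0 = lcm q0 1" by simp
  have sizes: "q0 - 1 \<le> size (fibre M (q0, j0))" "1 - 1 \<le> size (fibre M (1, 0))"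
    using fibre_M size_M by simp_all
  obtain X1 X2 where X0: "X1 + X2 \<subseteq># M" "size X1 < q0" "size X2 < 1"
    "weight q0 (X1 + X2) \<le> p \<Longrightarrow> q0 dvd p - weight q0 (X1 + X2)"
    by (rule base[OF assms(2) one _ l _ sizes]) (simp, use M' in blast, blast)
  have "X2 = {#}" using X0(3) by simp
  \<comment> \<open>Fewer than \<open>q0 \<le> 9\<close> terms, each of weight at most
    \<open>p / 10\<close>.\<close>
  have "weight q0 (X1 + X2) \<le> size (X1 + X2) * ((q0 div q0) * (p div 10))"
  proof (rule weight_le)
    show "X1 + X2 \<subseteq># W" using X0(1) MW by (rule subset_mset.order_trans)
    fix y assume "y \<in># X1 + X2"
    then have y: "y \<in># M" using X0(1) by (meson mset_subset_eqD)
    show "right y \<and> q y = q0 \<and> err y \<le> p div 10 \<and> (q0 div q0) * err y < p"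
      using M[OF y] M'[OF y] err_bound[of y] q0(1) by (simp add: less_eq_div_iff_mult_less_eq)
  qed simp
  also have "\<dots> \<le> 10 * (p div 10)"
    using X0(2) \<open>X2 = {#}\<close> q0 by (intro mult_le_mono) auto
  also have "\<dots> \<le> p" by simp
  finally have "weight q0 (X1 + X2) \<le> p" .
  then obtain X where X: "X \<subseteq># M" "weight q0 X + q0 * h < p"
    "\<And>c. c \<in> fractions \<Longrightarrow> size (fibre (M - X) c) < fst c"
    using residual[OF assms(1), of q0 M "X1 + X2"] q0 p_large MW M M' X0(1,4) by auto
  have "size (fibre (M - X) (q0, j0)) < q0" using X(3)[OF assms(2)] by simp
  moreover have "\<forall>y\<in>#M - X. (q y, j y) = (q0, j0)"
    using M in_diffD by fastforce
  then have "fibre (M - X) (q0, j0) = M - X"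
    by (simp add: filter_mset_eq_conv del: filter_diff_mset)
  moreover have "size (M - X) = size M - size X" using X(1) by (rule size_Diff_submset)
  ultimately have size_X: "162 \<le> size X" using size_M by simp
  have "size X * p \<le> (\<Sum>y\<in>#X. 162 * (q0 * y mod p))"
  proof (rule size_times_le_sum_mset)
    fix y assume "y \<in># X"
    then have y: "y \<in># M" using X(1) by (meson mset_subset_eqD)
    show "p \<le> 162 * (q0 * y mod p)"
      using weight_right[of y q0] M[OF y] M'[OF y] q0 by simp
  qed
  also have "\<dots> = 162 * weight q0 X" by (simp add: weight_def sum_mset_distrib_left)
  finally have "162 * p \<le> 162 * weight q0 X"
    using mult_le_mono1[OF size_X, of p] by linarith
  then show False using X(2) by simp
qed

text \<open>For \<open>r\<close> equal to \<open>q1\<close> or \<open>q2\<close>, fewer than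
  \<open>r\<close> terms of weight at most \<open>(m div r) * (p div 162)\<close> give at most
  \<open>81 * p / 162\<close>, half of \<open>p\<close> per group.\<close>

lemma base_small:
  assumes c: "(q1, j1) \<in> fractions" "(q2, j2) \<in> fractions" "q1 \<noteq> q2 \<or> q2 = 1"
    and MW: "M \<subseteq># W" and M: "\<And>y. y \<in># M \<Longrightarrow> right y \<and> 162 * err y \<le> p"
    and sizes: "q1 - 1 \<le> size (fibre M (q1, j1))" "q2 - 1 \<le> size (fibre M (q2, j2))"
  defines "m \<equiv> lcm q1 q2"
  obtains X where "X \<subseteq># M" "weight m X \<le> p" "m dvd p - weight m X"
proof -
  have q12: "1 \<le> q1" "q1 \<le> 9" "1 \<le> q2" "q2 \<le> 9" using c by (auto simp: fractions_def)
  have "m \<le> q1 * q2" unfolding m_def using q12 by (intro dvd_imp_le) auto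
  also have "\<dots> \<le> 9 * 9" using q12 by (intro mult_le_mono)
  finally have m: "m \<le> 81" by simp
  have qW: "q y \<noteq> 0" if "y \<in># M" for y using q_range[of y] mset_subset_eqD[OF MW that] by simp
  obtain X1 X2 where X: "X1 + X2 \<subseteq># M" "size X1 < q1" "size X2 < q2"
    "\<And>y. y \<in># X1 \<Longrightarrow> q y = q1 \<and> j y = j1" "\<And>y. y \<in># X2 \<Longrightarrow> q y = q2 \<and> j y = j2"
    "weight m (X1 + X2) \<le> p \<Longrightarrow> m dvd p - weight m (X1 + X2)"
    by (rule base[OF c m_def[THEN meta_eq_to_obj_eq] _ sizes]) (use M err_mult_less_p qW m in auto)
  have bound: "162 * weight m Y \<le> 81 * p"
    if "Y \<subseteq># M" "size Y < r" "r dvd m" "\<And>y. y \<in># Y \<Longrightarrow> q y = r" for Y r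
  proof -
    have "weight m Y \<le> size Y * ((m div r) * (p div 162))"
    proof (rule weight_le)
      show "Y \<subseteq># W" using that(1) MW by (rule subset_mset.order_trans)
      fix y assume y: "y \<in># Y"
      then have yM: "y \<in># M" using that(1) by (meson mset_subset_eqD)
      show "right y \<and> q y = r \<and> err y \<le> p div 162 \<and> (m div r) * err y < p"
        using M[OF yM] err_mult_less_p[of y m] qW[OF yM] m that(4)[OF y]
        by (auto simp: less_eq_div_iff_mult_less_eq mult.commute)
    qed (rule that(3))
    also have "\<dots> \<le> r * ((m div r) * (p div 162))"
      using that(2) by (intro mult_le_mono1) simp
    also have "\<dots> = m * (p div 162)" using that(3) by (metis dvd_mult_div_cancel mult.assoc)
    also have "\<dots> \<le> 81 * (p div 162)" using m by (rule mult_le_mono1)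
    finally have "162 * weight m Y \<le> 81 * (162 * (p div 162))" by simp
    also have "\<dots> \<le> 81 * p" by (intro mult_le_mono2) simp
    finally show ?thesis .
  qed
  have "162 * weight m X1 \<le> 81 * p"
    by (rule bound[of X1 q1]) (use X in \<open>auto simp: m_def dest: subset_mset.order_trans[OF mset_subset_eq_add_left]\<close>)
  moreover have "162 * weight m X2 \<le> 81 * p"
    by (rule bound[of X2 q2]) (use X in \<open>auto simp: m_def dest: subset_mset.order_trans[OF mset_subset_eq_add_right]\<close>)
  ultimately have "weight m (X1 + X2) \<le> p" by simp
  then show thesis using that X(1,6) by blast
qed

text \<open>For \<open>m \<ge> 10\<close> the ones reach \<open>m * h \<ge> p - 1\<close>, so any
  positive weight from \<open>base_small\<close> is completed to \<open>p\<close>. Weight 0 would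
  give \<open>m dvd p\<close>, impossible for \<open>10 \<le> m < p\<close>.\<close>

lemma lcm_le_9:
  assumes "\<not> solvable"
    and c: "(q1, j1) \<in> fractions" "(q2, j2) \<in> fractions" "q1 \<noteq> q2"
    and MW: "M \<subseteq># W" and M: "\<And>y. y \<in># M \<Longrightarrow> right y \<and> 162 * err y \<le> p"
    and sizes: "q1 - 1 \<le> size (fibre M (q1, j1))" "q2 - 1 \<le> size (fibre M (q2, j2))"
  shows "lcm q1 q2 \<le> 9"
proof (rule ccontr)
  define m where "m = lcm q1 q2"
  assume "\<not> ?thesis"
  then have m10: "10 \<le> m" by (simp add: m_def)
  have q12: "1 \<le> q1" "q1 \<le> 9" "1 \<le> q2" "q2 \<le> 9" using c by (auto simp: fractions_def)
  have "m \<le> q1 * q2" unfolding m_def using q12 by (intro dvd_imp_le) auto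
  also have "\<dots> \<le> 9 * 9" using q12 by (intro mult_le_mono)
  finally have mp: "m < p" using p_large by simp
  obtain X where X: "X \<subseteq># M" "weight m X \<le> p" "m dvd p - weight m X"
    using base_small[OF c(1,2) _ MW M sizes] c(3) unfolding m_def by blast
  have "weight m X \<noteq> 0"
  proof
    assume "weight m X = 0"
    then have "m dvd p" using X(3) by simp
    then show False using prime_p m10 mp by (auto simp: prime_nat_iff)
  qed
  moreover have "10 * h \<le> m * h" using m10 by (rule mult_le_mono1)
  ultimately have "p \<le> weight m X + m * h" using h by linarith
  moreover have "X \<subseteq># W" using X(1) MW by (rule subset_mset.order_trans)
  ultimately show False
    using assms(1) X(2,3) m10 mp unfolding solvable_def by (metis gr0I not_numeral_le_zero)
qed

section \<open>Counting all terms\<close>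

text \<open>Multiplication by \<open>m\<close> permutes the nonzero residues, so the value 1 comes
  from a single residue, of multiplicity at most \<open>h\<close>, and all other values are at least
  2. For \<open>m = 1\<close> that residue is 1 itself, which \<open>W\<close> excludes.\<close>

lemma weight_lower_bound:
  assumes "X \<subseteq># W" "0 < m" "m < p"
  shows "2 * size X \<le> weight m X + (if m = 1 then 0 else h)"
proof -
  have range: "2 \<le> y \<and> y < p" if "y \<in># X" for y
    using W_range mset_subset_eqD[OF assms(1) that] by blast
  have "2 * size X \<le> weight m X + size (filter_mset (\<lambda>y. m * y mod p = 1) X)"
    unfolding weight_def
  proof (rule two_size_le_sum_mset)
    fix y assume "y \<in># X"
    then have "\<not> p dvd m" "\<not> p dvd y" using range[of y] assms(2,3) by (auto dest: dvd_imp_le)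
    then have "\<not> p dvd m * y" using prime_p by (simp add: prime_dvd_mult_iff)
    then show "1 \<le> m * y mod p" by (simp add: dvd_eq_mod_eq_0 Suc_le_eq)
  qed
  moreover have "size (filter_mset (\<lambda>y. m * y mod p = 1) X) \<le> (if m = 1 then 0 else h)"
  proof (cases "filter_mset (\<lambda>y. m * y mod p = 1) X = {#}")
    case False
    then obtain y where "y \<in># filter_mset (\<lambda>y. m * y mod p = 1) X" by blast
    then have y: "y \<in># X" "m * y mod p = 1" by auto
    have "z = y" if "z \<in># X" "m * z mod p = 1" for z
    proof -
      have "[m * z = m * y] (mod p)" using that(2) y(2) by (simp add: cong_def)
      moreover have "coprime m p" using prime_p assms(2,3)
        by (metis coprime_commute dvd_imp_le not_less prime_imp_coprime)
      ultimately have "[z = y] (mod p)" by (simp add: cong_mult_lcancel_nat)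
      then show ?thesis using range[OF that(1)] range[OF y(1)] by (simp add: cong_def)
    qed
    then have "filter_mset (\<lambda>y. m * y mod p = 1) X = filter_mset (\<lambda>z. z = y) X"
      using y(2) by (intro filter_mset_cong) auto
    then have "size (filter_mset (\<lambda>y. m * y mod p = 1) X) = count X y"
      by (simp only: filter_eq_replicate_mset size_replicate_mset)
    also have "\<dots> \<le> h" using assms(1) count_W[of y] by (meson mset_subset_eq_count le_trans)
    finally show ?thesis using y range[OF y(1)] by auto
  next
    case True
    then show ?thesis by (simp only: size_empty le0)
  qed
  ultimately show ?thesis by linarith
qed


text \<open>For each of the 29 fractions, at most 8 terms lie on the left, 169 have a large error, 8 have
  a rare denominator and 8 remain outside the maximal \<open>X\<close>; this gives \<open>11194 = 2 * 29 * 193\<close>.\<close>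

lemma h_large:
  assumes "\<not> solvable"
  shows "p < h + 11194"
proof -
  define V' where "V' = filter_mset (\<lambda>y. right y \<and> 162 * err y \<le> p) W"
  \<comment> \<open>The frequent denominators: \<open>s - 1\<close> terms with a common fraction are
    what \<open>base\<close> asks for.\<close>
  define Q where "Q = {s. \<exists>j0. (s, j0) \<in> fractions \<and> s - 1 \<le> size (fibre V' (s, j0))}"
  have V'W: "V' \<subseteq># W" unfolding V'_def by (rule multiset_filter_subset)
  have V': "right y \<and> 162 * err y \<le> p" if "y \<in># V'" for y using that by (simp add: V'_def)
  have Q_sub: "Q \<subseteq> {1..9}" unfolding Q_def by (auto simp: fractions_def)
  \<comment> \<open>The bound \<open>1 - 1 = 0\<close> makes 1 frequent even if no term has
    denominator 1.\<close>
  have "1 \<in> Q" unfolding Q_def by (auto simp: fractions_def intro!: exI[of _ 0])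
  moreover have "lcm s t \<le> 9" if "s \<in> Q" "t \<in> Q" "s \<noteq> t" for s t
    using that lcm_le_9[OF assms _ _ that(3) V'W V'] unfolding Q_def by blast
  ultimately obtain q1 q2 where q12: "q1 \<in> Q" "q2 \<in> Q" "q1 \<noteq> q2 \<or> q2 = 1" "lcm q1 q2 \<le> 9"
    "\<And>s. s \<in> Q \<Longrightarrow> s dvd lcm q1 q2"
    using dominating_pair[OF Q_sub] by metis
  define m where "m = lcm q1 q2"
  define V where "V = filter_mset (\<lambda>y. q y \<in> Q) V'"
  have VV': "V \<subseteq># V'" unfolding V_def by (rule multiset_filter_subset)
  have VW: "V \<subseteq># W" using VV' V'W by (rule subset_mset.order_trans)
  have V: "right y \<and> 162 * err y \<le> p" if "y \<in># V" for y
    using V' mset_subset_eqD[OF VV' that] by blast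
  have fibre_V: "fibre V (s, i) = fibre V' (s, i)" if "s \<in> Q" for s i
    unfolding V_def filter_filter_mset using that by (intro filter_mset_cong) auto
  obtain j1 j2 where j12: "(q1, j1) \<in> fractions" "q1 - 1 \<le> size (fibre V (q1, j1))"
    "(q2, j2) \<in> fractions" "q2 - 1 \<le> size (fibre V (q2, j2))"
    using q12(1,2) fibre_V unfolding Q_def by fastforce
  have "0 < q1" "0 < q2" using subsetD[OF Q_sub q12(1)] subsetD[OF Q_sub q12(2)] by simp_all
  then have m: "0 < m" "m \<le> 9" using q12(4) unfolding m_def by (simp_all add: lcm_pos_nat)
  obtain X0 where X0: "X0 \<subseteq># V" "weight m X0 \<le> p" "m dvd p - weight m X0"
    using base_small[OF j12(1,3) q12(3) VW V j12(2,4)] unfolding m_def by blast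
  have "right y \<and> q y dvd m \<and> (m div q y) * err y < p" if "y \<in># V" for y
    using V[OF that] err_mult_less_p[of y m] q_range[OF mset_subset_eqD[OF VW that]] m q12(5)[of "q y"] that
    unfolding m_def[symmetric] by (simp add: V_def)
  then obtain X where X: "X \<subseteq># V" "weight m X + m * h < p"
    "\<And>c. c \<in> fractions \<Longrightarrow> size (fibre (V - X) c) < fst c"
    using residual[OF assms m(1) _ VW _ X0] m p_large by auto
  have XW: "X \<subseteq># W" using X(1) VW by (rule subset_mset.order_trans)
  have "size (W - X) \<le> card fractions * 193"
  proof (rule size_le_card_times_fibre[OF finite_fractions])
    show "(q y, j y) \<in> fractions" if "y \<in># W - X" for y
      using frac in_diffD[OF that] by blast
    fix c assume c: "c \<in> fractions"
    then obtain s i where si: "c = (s, i)" "1 \<le> s" "s \<le> 9" by (cases c) (auto simp: fractions_def)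
    define A where "A = filter_mset (\<lambda>y. \<not> right y) W"
    define B where "B = filter_mset (\<lambda>y. right y \<and> p < 162 * err y) W"
    define C where "C = filter_mset (\<lambda>y. q y \<notin> Q) V'"
    \<comment> \<open>In order: left terms, large errors, rare denominators, and the terms from
      which \<open>X\<close> is chosen.\<close>
    have "W = A + B + C + V"
      by (rule multiset_eqI) (auto simp: A_def B_def C_def V_def V'_def)
    then have "W - X = A + B + C + (V - X)"
      using X(1) by (simp add: subset_mset.add_diff_assoc)
    then have "size (fibre (W - X) c) = size (fibre A c) + size (fibre B c) + size (fibre C c) + size (fibre (V - X) c)"
      by (simp only: filter_union_mset size_union)
    moreover have "size (fibre A c) \<le> 8"
      using few_left[OF assms c] si unfolding A_def by simp
    moreover have "size (fibre B c) \<le> 169"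
      using few_large[OF assms c[unfolded si(1)]] si(3) unfolding B_def si(1) by linarith
    moreover have "size (fibre C c) \<le> 8"
    proof (cases "s \<in> Q")
      case True
      then have "size (fibre C c) = size (filter_mset (\<lambda>_. False) V')"
        unfolding C_def filter_filter_mset using si(1) by (intro arg_cong[of _ _ size] filter_mset_cong) auto
      also have "\<dots> = 0" by simp
      finally show ?thesis by linarith
    next
      case False
      then have "size (fibre V' c) < s - 1" using c si unfolding Q_def by auto
      moreover have "fibre C c \<subseteq># fibre V' c"
        unfolding C_def by (intro multiset_filter_mono multiset_filter_subset)
      then have "size (fibre C c) \<le> size (fibre V' c)" by (rule size_mset_mono)
      ultimately show ?thesis using si(3) by linarith
    qed
    moreover have "size (fibre (V - X) c) \<le> 8"
      using X(3)[OF c] si by simp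
    ultimately show "size (fibre (W - X) c) \<le> 193" by linarith
  qed
  then have "size W \<le> size X + 5597"
    using size_Diff_submset[OF XW] by (simp add: card_fractions)
  moreover have "2 * size X \<le> weight m X + (if m = 1 then 0 else h)"
    using weight_lower_bound[OF XW m(1)] m(2) p_large by simp
  \<comment> \<open>For \<open>m \<ge> 2\<close> the up to \<open>h\<close> weights equal to 1 are
    paid for by a second \<open>h\<close> in \<open>m * h\<close>; for \<open>m = 1\<close> there
    are none.\<close>
  moreover have "(if m = 1 then 0 else h) + h \<le> m * h"
  proof (cases "m = 1")
    case False
    then have "2 * h \<le> m * h" using m(1) by (intro mult_le_mono1) simp
    then show ?thesis by (subst if_not_P[OF False]) linarith
  qed simp
  \<comment> \<open>Now \<open>2 * size X + h < p\<close>, while \<open>size W = p - h\<close>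
    exceeds \<open>size X\<close> by at most 5597.\<close>
  ultimately show ?thesis using X(2) size_W by linarith
qed

text \<open>Since almost all terms are ones, \<open>m = 1\<close> suffices: either one term and some
  ones give \<open>p\<close>, or every term is at most \<open>h\<close> and can be added without
  jumping over the window. Then all of \<open>W\<close> is used, but its weight is at least
  \<open>2 * (p - h)\<close>, too much to stay below \<open>p - h\<close>.\<close>

theorem always_solvable: solvable
proof (rule ccontr)
  assume not: "\<not> solvable"
  have mod: "y mod p = y" if "y \<in># W" for y using W_range[OF that] by simp
  have small: "y \<le> h" if "y \<in># W" for y
  proof (rule ccontr)
    assume "\<not> y \<le> h"
    \<comment> \<open>Both \<open>y\<close> and \<open>h\<close> exceed \<open>p - 11194\<close>,
      and \<open>p > 2 * 11194\<close>.\<close>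
    then have "p \<le> y + h" using h_large[OF not] p_large by linarith
    then have "solvable"
      unfolding solvable_def using that W_range[OF that] p_large
      by (intro exI[of _ 1] exI[of _ "{#y#}"]) (simp add: weight_def)
    then show False using not by simp
  qed
  obtain X where X: "X \<subseteq># W" "weight 1 X \<le> p"
    and block: "\<And>B. \<lbrakk>p > weight 1 X + h; B \<subseteq># W - X; weight 1 B \<le> h\<rbrakk> \<Longrightarrow> B = {#}"
    using submset_no_small_block[of "{#}" W "\<lambda>y. 1 * y mod p" p 1 h] unfolding weight_def by auto
  have less: "weight 1 X + h < p"
  proof (rule ccontr)
    assume "\<not> ?thesis"
    then have "solvable"
      unfolding solvable_def using X p_large by (intro exI[of _ 1] exI[of _ X]) simp
    then show False using not by simp
  qed
  have "W - X = {#}"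
  proof (rule ccontr)
    assume "W - X \<noteq> {#}"
    then obtain y where y: "y \<in># W - X" by blast
    then have "weight 1 {#y#} \<le> h" using small[of y] mod[of y] by (simp add: weight_def in_diffD)
    then show False using block[OF less, of "{#y#}"] y by simp
  qed
  then have "X = W" using X(1) by (metis Diff_eq_empty_iff_mset subset_mset.antisym)
  then show False
    using weight_lower_bound[of W 1] less size_W p_large by simp
qed

end

section \<open>From sequences of residues to the normalized setting\<close>

lemma index_one_multiplier:
  fixes S :: "nat multiset"
  assumes p: "prime p" "24318 < p" and S: "size S = p" "set_mset S \<subseteq> {1..<p}"
    and max: "\<And>y. count S y \<le> count S 1" and h: "p - 2 \<le> 10 * count S 1"
  obtains T m where "T \<subseteq># S" "0 < m" "m < p" "(\<Sum>y\<in>#T. m * y mod p) = p"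
proof -
  define h W where "h = count S 1" and "W = filter_mset (\<lambda>y. y \<noteq> 1) S"
  have S_eq: "S = W + replicate_mset h 1"
    unfolding W_def h_def by (rule multiset_eqI) auto
  have W: "2 \<le> y \<and> y < p" if "y \<in># W" for y
    using that S(2) unfolding W_def by fastforce
  have "\<exists>c. c \<in> fractions \<and> 10 * \<bar>int (fst c * y) - int (snd c * p)\<bar> \<le> int p" if "y \<in># W" for y
  proof -
    obtain q j where qj: "q \<in> {1..9}" "coprime q j" "int (9 + 1) * \<bar>int (q * y) - int (j * p)\<bar> \<le> int p"
      using dirichlet_approx_nat[of p 9 y] p(2) by auto
    have "q * y < q * p" using qj(1) W[OF that] by simp
    moreover have "10 * b \<le> 10 * a + p" if "int (9 + 1) * \<bar>int a - int b\<bar> \<le> int p" for a b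
    proof -
      have "int b - int a \<le> \<bar>int a - int b\<bar>" by simp
      then have "int (10 * b) \<le> int (10 * a + p)" using that by simp
      then show ?thesis by (simp only: of_nat_le_iff)
    qed
    from this[OF qj(3)] have "10 * (j * p) \<le> 10 * (q * y) + p" .
    moreover have "q * p + p \<le> j * p" if "\<not> j \<le> q"
      using mult_le_mono1[of "q + 1" j p] that by simp
    \<comment> \<open>Since \<open>y < p\<close>, the product \<open>j * p\<close> is less than
      \<open>q * p + p / 10\<close>.\<close>
    ultimately have "j \<le> q" using p(2) by linarith
    then show ?thesis using qj by (intro exI[of _ "(q, j)"]) (auto simp: fractions_def)
  qed
  then obtain c where c: "\<And>y. y \<in># W \<Longrightarrow> c y \<in> fractions \<and> 10 * \<bar>int (fst (c y) * y) - int (snd (c y) * p)\<bar> \<le> int p"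
    by metis
  \<comment> \<open>Parity excludes \<open>p = 10 * h + 2\<close> and sharpens the hypothesis to
    \<open>p \<le> 10 * h + 1\<close>.\<close>
  have "odd p" using p prime_odd_nat by auto
  then have "p \<noteq> 10 * h + 2" by auto
  interpret normalized_sequence p h W "\<lambda>y. fst (c y)" "\<lambda>y. snd (c y)"
  proof
    show "p \<le> 10 * h + 1" using h \<open>p \<noteq> 10 * h + 2\<close> unfolding h_def by linarith
    show "size W + h = p" using S(1) S_eq by (metis size_replicate_mset size_union)
    show "count W y \<le> h" for y using max[of y] unfolding W_def h_def by simp
  qed (use p W c in auto)
  obtain m X where mX: "0 < m" "m < p" "X \<subseteq># W" "weight m X \<le> p" "p \<le> weight m X + m * h" "m dvd p - weight m X"
    using always_solvable unfolding solvable_def by blast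
  obtain k where k: "p - weight m X = m * k" using mX(6) by (auto elim!: dvdE)
  then have "m * k \<le> m * h" using mX(5) by linarith
  then have "k \<le> h" using mX(1) by simp
  then have "X + replicate_mset k 1 \<subseteq># S"
    unfolding S_eq using mX(3) by (intro subset_mset.add_mono) (auto simp: subseteq_mset_def)
  moreover have "(\<Sum>y\<in>#X + replicate_mset k 1. m * y mod p) = p"
    using k mX(2,4) unfolding weight_def by (simp add: mult.commute)
  ultimately show thesis using that mX(1,2) by blast
qed

section \<open>Index in groups of prime order\<close>

lemma count_le_count_image_mset: "count M x \<le> count (image_mset f M) (f x)"
  by (induction M) auto

context group
begin

lemma coefficient_nat_pow:
  assumes "finite (carrier G)" "h \<in> carrier G" "ord h = order G"
  shows "coefficient G h (h [^] v) = (if order G dvd v then order G else v mod order G)"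
proof -
  define n where "n = (if order G dvd v then order G else v mod order G)"
  have pos: "order G > 0" using assms(1) order_gt_0_iff_finite by blast
  then have range: "n \<in> {1..order G}"
    unfolding n_def by (auto simp: dvd_eq_mod_eq_0 Suc_le_eq less_imp_le)
  have "h [^] v = h [^] (v mod order G)"
  proof -
    have "h [^] v = h [^] (order G * (v div order G) + v mod order G)" by simp
    also have "\<dots> = (h [^] order G) [^] (v div order G) \<otimes> h [^] (v mod order G)"
      using assms(2) by (simp only: nat_pow_mult[symmetric] nat_pow_pow)
    also have "h [^] order G = \<one>" using assms(2,3) pow_ord_eq_1 by metis
    finally show ?thesis using assms(2) by simp
  qed
  moreover have "h [^] order G = \<one>" using assms(2,3) pow_ord_eq_1 by metis
  ultimately have "h [^] v = h [^] n" unfolding n_def by (simp add: dvd_eq_mod_eq_0)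
  then have "n \<in> {1..order G} \<and> h [^] v = h [^] n" using range by simp
  then show ?thesis
    unfolding coefficient_def n_def[symmetric]
    using coefficient_ex1[OF assms, of "h [^] v"] assms(2) by (intro the1_equality) auto
qed

lemma coefficient_props:
  assumes "finite (carrier G)" "h \<in> carrier G" "ord h = order G" "x \<in> carrier G"
  shows "coefficient G h x \<in> {1..order G}" "h [^] coefficient G h x = x"
  using theI'[OF coefficient_ex1[OF assms]] unfolding coefficient_def by auto

text \<open>Exponent \<open>n\<close> to the base \<open>h0\<close> is exponent \<open>m * n\<close>
  to the base \<open>h\<close>. So divisibility of the coefficient sum by the order passes from one
  generator to another.\<close>

lemma sum_coefficient_mod:
  assumes "finite (carrier G)" "h \<in> carrier G" "ord h = order G" "h0 = h [^] m" "ord h0 = order G"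
    and "set_mset T \<subseteq> carrier G"
  shows "(\<Sum>x\<in>#T. coefficient G h x) mod order G = m * (\<Sum>x\<in>#T. coefficient G h0 x) mod order G"
  using assms(6)
proof (induction T)
  case (add x T)
  have h0: "h0 \<in> carrier G" using assms(2,4) by simp
  have x: "x \<in> carrier G" using add.prems by simp
  have "x = h [^] (m * coefficient G h0 x)"
    using coefficient_props(2)[OF assms(1) h0 assms(5) x] assms(2,4) by (simp add: nat_pow_pow)
  then have "coefficient G h x mod order G = m * coefficient G h0 x mod order G"
    using coefficient_nat_pow[OF assms(1-3), of "m * coefficient G h0 x"] by (simp split: if_splits)
  then show ?case
    using add by (simp add: distrib_left) (metis mod_add_cong)
qed simp

text \<open>One generator of norm 1 suffices: for every other generator the coefficient sum is again
  a multiple of the order, and it is positive, so the norm is at least 1.\<close>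

lemma seq_index_eq_1:
  assumes "finite (carrier G)" "h0 \<in> carrier G" "ord h0 = order G" "set_mset T \<subseteq> carrier G"
    and norm: "(\<Sum>x\<in>#T. coefficient G h0 x) = order G"
  shows "seq_index G T = 1"
proof -
  have pos: "order G > 0" using assms(1) order_gt_0_iff_finite by blast
  have real_sum: "(\<Sum>x\<in>#T. real (coefficient G h x)) = real (\<Sum>x\<in>#T. coefficient G h x)" for h
    by (induction T) auto
  define A where "A = {seq_norm G h T | h. h \<in> carrier G \<and> ord h = order G}"
  have A_eq: "A = (\<lambda>h. seq_norm G h T) ` {h \<in> carrier G. ord h = order G}"
    unfolding A_def by auto
  have "finite A" using assms(1) unfolding A_eq by simp
  moreover have "1 \<in> A"
  proof -
    have "1 = seq_norm G h0 T" unfolding seq_norm_def real_sum norm using pos by simp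
    then show ?thesis
      unfolding A_eq using assms(2,3) by (intro image_eqI[of _ _ h0]) simp_all
  qed
  moreover have "1 \<le> a" if "a \<in> A" for a
  proof -
    from that[unfolded A_eq] obtain h where "a = seq_norm G h T" "h \<in> {h \<in> carrier G. ord h = order G}"
      by (rule imageE)
    then have h: "h \<in> carrier G" "ord h = order G" "a = seq_norm G h T" by simp_all
    have "h0 = h [^] coefficient G h h0"
      by (rule coefficient_props(2)[OF assms(1) h(1,2) assms(2), symmetric])
    then have "(\<Sum>x\<in>#T. coefficient G h x) mod order G = coefficient G h h0 * order G mod order G"
      using sum_coefficient_mod[OF assms(1) h(1,2) _ assms(3,4), of "coefficient G h h0"] norm by simp
    then have "order G dvd (\<Sum>x\<in>#T. coefficient G h x)"
      by (simp add: dvd_eq_mod_eq_0)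
    moreover have "T \<noteq> {#}" using norm pos by (intro notI) simp
    then obtain x where x: "x \<in># T" by blast
    then obtain T' where "T = add_mset x T'" by (blast dest: multi_member_split)
    then have "coefficient G h x \<le> (\<Sum>x\<in>#T. coefficient G h x)" by simp
    moreover have "1 \<le> coefficient G h x" using coefficient_props(1)[OF assms(1) h(1,2)] x assms(4) by auto
    ultimately have "order G \<le> (\<Sum>x\<in>#T. coefficient G h x)"
      by (intro dvd_imp_le) linarith+
    then have "real (order G) \<le> real (\<Sum>x\<in>#T. coefficient G h x)" by (simp only: of_nat_le_iff)
    then show ?thesis
      unfolding h(3) seq_norm_def real_sum using pos by (subst le_divide_eq_1_pos) simp_all
  qed
  ultimately have "Min A = 1" by (intro Min_eqI) auto
  then show ?thesis unfolding seq_index_def A_def .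
qed

lemma ord_eq_prime_order:
  assumes "prime (order G)" "x \<in> carrier G" "x \<noteq> \<one>"
  shows "ord x = order G"
  using ord_dvd_group_order[OF assms(2)] assms by (metis ord_eq_1 prime_nat_iff)

text \<open>If the identity does not occur, the most frequent term \<open>g\<close> generates the
  group. The exponents to the base \<open>g\<close> form a sequence of residues with 1 most
  frequent, and a multiplier \<open>m\<close> amounts to a change of generator.\<close>

lemma ex_subsequence_index_1:
  assumes "prime p" "p > 24318" "order G = p" "sequence_over G S" "size S = p"
    and "real (max_mult G S) \<ge> (real p - 2) / 10"
  shows "\<exists>T. T \<subseteq># S \<and> seq_index G T = 1"
proof -
  have fin: "finite (carrier G)" using assms(2,3) order_gt_0_iff_finite by simp
  have SG: "set_mset S \<subseteq> carrier G" using assms(4) by (simp add: sequence_over_def)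
  show ?thesis
  proof (cases "\<one> \<in># S")
    case True
    have "\<exists>x. x \<in> carrier G \<and> x \<noteq> \<one>"
    proof (rule ccontr)
      assume "\<not> ?thesis"
      then have "carrier G = {\<one>}" by auto
      then have "order G = 1" by (simp add: order_def)
      then show False using assms(2,3) by simp
    qed
    then obtain g where g: "g \<in> carrier G" "ord g = order G"
      using ord_eq_prime_order assms(1,3) by blast
    \<comment> \<open>The identity has coefficient \<open>order G\<close>, so alone it has norm
      1.\<close>
    have "coefficient G g \<one> = order G"
      using coefficient_nat_pow[OF fin g, of 0] by simp
    then have "seq_index G {#\<one>#} = 1"
      by (intro seq_index_eq_1[OF fin g]) auto
    then show ?thesis using True by (intro exI[of _ "{#\<one>#}"]) simp
  next
    case False
    have "Max (count S ` carrier G) \<in> count S ` carrier G"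
      using fin by (intro Max_in) auto
    then obtain g where g: "g \<in> carrier G" "count S g = max_mult G S"
      unfolding max_mult_def by (metis imageE)
    have max: "count S x \<le> count S g" if "x \<in> carrier G" for x
      using that fin unfolding g(2) max_mult_def by (intro Max_ge) auto
    have "real (p - 2) \<le> real (10 * count S g)"
      using assms(2,6) g(2) by (simp add: of_nat_diff field_simps)
    then have count_g: "p - 2 \<le> 10 * count S g" by (simp only: of_nat_le_iff)
    then have "g \<in># S" using assms(2) by (cases "g \<in># S") (auto simp: not_in_iff)
    then have "g \<noteq> \<one>" using False by auto
    then have ord_g: "ord g = order G" using ord_eq_prime_order g(1) assms(1,3) by blast
    define S' where "S' = image_mset (coefficient G g) S"
    have S_eq: "S = image_mset (\<lambda>n. g [^] n) S'"
    proof -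
      have "image_mset (\<lambda>n. g [^] n) S' = image_mset (\<lambda>x. x) S"
        unfolding S'_def multiset.map_comp
        by (rule image_mset_cong) (use coefficient_props(2)[OF fin g(1) ord_g] SG in auto)
      then show ?thesis by simp
    qed
    have coeff_g: "coefficient G g g = 1"
      using coefficient_nat_pow[OF fin g(1) ord_g, of 1] g(1) assms(2,3) by simp
    have "count S g \<le> count S' 1"
      using count_le_count_image_mset[of S g "coefficient G g"] coeff_g unfolding S'_def by simp
    \<comment> \<open>\<open>S\<close> consists of the powers of \<open>g\<close> with exponents in
      \<open>S'\<close>, so no exponent is more frequent than \<open>g\<close> is in
      \<open>S\<close>.\<close>
    moreover have "count S' y \<le> count S g" for y
      using count_le_count_image_mset[of S' y "\<lambda>n. g [^] n"] max[of "g [^] y"] g(1) S_eq by simp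
    ultimately have "count S' y \<le> count S' 1" "p - 2 \<le> 10 * count S' 1" for y
      using count_g le_trans by (blast, linarith)
    moreover have "set_mset S' \<subseteq> {1..<p}"
    proof
      fix n assume "n \<in># S'"
      then obtain x where x: "x \<in># S" "n = coefficient G g x" unfolding S'_def by auto
      then have n: "n \<in> {1..p}" "g [^] n = x"
        using coefficient_props[OF fin g(1) ord_g, of x] SG assms(3) by auto
      have "n \<noteq> p" using n(2) x(1) False g(1) ord_g assms(3) pow_ord_eq_1 by metis
      then show "n \<in> {1..<p}" using n(1) by simp
    qed
    moreover have "size S' = p" using assms(5) by (simp add: S'_def)
    ultimately obtain T' m where T': "T' \<subseteq># S'" "0 < m" "m < p" "(\<Sum>y\<in>#T'. m * y mod p) = p"
      using index_one_multiplier[OF assms(1,2)] by metis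
    have S'_range: "0 < y \<and> y < p" if "y \<in># T'" for y
      using \<open>set_mset S' \<subseteq> {1..<p}\<close> mset_subset_eqD[OF T'(1) that] by auto
    have "\<not> p dvd m" using T'(2,3) by (auto dest: dvd_imp_le)
    then have "coprime m p" using assms(1) prime_imp_coprime coprime_commute by blast
    then obtain m' where m': "[m * m' = 1] (mod p)" using cong_solve_coprime_nat by auto
    \<comment> \<open>\<open>m'\<close> inverts \<open>m\<close> modulo \<open>p\<close>, so
      \<open>g = h0 [^] m\<close> and \<open>g [^] y\<close> has coefficient
      \<open>m * y mod p\<close> to the base \<open>h0\<close>.\<close>
    define h0 where "h0 = g [^] m'"
    have h0: "h0 \<in> carrier G" using g(1) by (simp add: h0_def)
    have "coefficient G g (h0 [^] m) = coefficient G g g"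
    proof -
      have "h0 [^] m = g [^] (m' * m)" unfolding h0_def using g(1) by (simp add: nat_pow_pow)
      moreover have "m' * m mod p = 1" using m' assms(2) by (simp add: cong_def mult.commute)
      ultimately show ?thesis
        using coefficient_nat_pow[OF fin g(1) ord_g, of "m' * m"] coeff_g assms(3) by (simp add: dvd_eq_mod_eq_0)
    qed
    then have g_eq: "g = h0 [^] m"
      using coefficient_props(2)[OF fin g(1) ord_g] g(1) h0 by (metis nat_pow_closed)
    then have "h0 \<noteq> \<one>" using \<open>g \<noteq> \<one>\<close> by auto
    then have ord_h0: "ord h0 = order G" using ord_eq_prime_order h0 assms(1,3) by blast
    define T where "T = image_mset (\<lambda>n. g [^] n) T'"
    have TS: "T \<subseteq># S" unfolding T_def S_eq using T'(1) by (rule image_mset_subseteq_mono)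
    have "coefficient G h0 (g [^] y) = m * y mod p" if "y \<in># T'" for y
    proof -
      have "\<not> p dvd y" using S'_range[OF that] by (auto dest: dvd_imp_le)
      then have "\<not> p dvd m * y" using \<open>\<not> p dvd m\<close> assms(1) by (simp add: prime_dvd_mult_iff)
      then show ?thesis
        using coefficient_nat_pow[OF fin h0 ord_h0, of "m * y"] assms(3) h0 g_eq by (simp add: nat_pow_pow)
    qed
    then have "(\<Sum>x\<in>#T. coefficient G h0 x) = (\<Sum>y\<in>#T'. m * y mod p)"
      unfolding T_def multiset.map_comp by (intro arg_cong[of _ _ sum_mset] image_mset_cong) simp
    then have "seq_index G T = 1"
      using seq_index_eq_1[OF fin h0 ord_h0, of T] T'(4) assms(3) SG set_mset_mono[OF TS] by auto
    then show ?thesis using TS by blast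
  qed
qed


end

theorem theorem1p4:
  fixes G :: "('a, 'b) monoid_scheme" and p :: nat and S :: "'a multiset"
  assumes "prime p" and "p > 24318"
    and "group G" and "cyclic_group G" and "order G = p"
    and "sequence_over G S" and "size S = p"
    and "real (max_mult G S) \<ge> (real p - 2) / 10"
  shows "\<exists>T. T \<subseteq># S \<and> seq_index G T = 1"
  using group.ex_subsequence_index_1[OF assms(3,1,2,5-8)] .

end
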